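(* Let $\mathcal{P}$ denote the set of symmetric totally non-negative $2 \times 2$ real matrices with positive entries, and let \[ \mathcal{P}' := \left\{ \begin{pmatrix} a & b \\ b & a \end{pmatrix} : a > b > 0,\ a \text{ and } b \text{ not both irrational} \right\}, \] \[ \mathcal{P}'' := \left\{ \begin{pmatrix} a & b \\ b & c \end{pmatrix} : a, b, c > 0,\ ac > b^2,\ a, b, c \text{ rational} \right\}. \] Let $F : (0,\infty) \to \mathbb{R}$ be a function. The following are equivalent. (1) $F[A]$ is totally non-negative for every $A \in \mathcal{P}$. (2) $F$ is non-negative, non-decreasing, and multiplicatively mid-convex on $(0,\infty)$. (3) $F[A]$ is positive semidefinite for every $A \in \mathcal{P}' \cup \mathcal{P}''$. Moreover, every such function is continuous, and is either nowhere zero or identically zero.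
   Context: For a matrix $A = (a_{ij})$ with positive entries, $F[A] := (F(a_{ij}))$. A real matrix is totally non-negative if all of its minors are non-negative. $F$ is multiplicatively mid-convex on $(0,\infty)$ if $F(\sqrt{xy})^2 \leq F(x)F(y)$ for all $x, y > 0$. *)

theory Defs
  imports Complex_Main "Jordan_Normal_Form.Determinant" "Jordan_Normal_Form.DL_Submatrix"
begin

definition totally_nonneg :: "real mat \<Rightarrow> bool" where
  "totally_nonneg A \<longleftrightarrow>
     (\<forall>I J. I \<subseteq> {..<dim_row A} \<longrightarrow> J \<subseteq> {..<dim_col A} \<longrightarrow> I \<noteq> {} \<longrightarrow> card I = card J \<longrightarrow>
        0 \<le> det (submatrix A I J))"

definition pos_semidef :: "real mat \<Rightarrow> bool" where
  "pos_semidef A \<longleftrightarrow>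
     square_mat A \<and> transpose_mat A = A \<and>
     (\<forall>v \<in> carrier_vec (dim_row A). 0 \<le> v \<bullet> (A *\<^sub>v v))"

(* The domain of F is the open half-line (0,\<infinity>): only the values at positive arguments matter. *)
definition mult_mid_convex :: "(real \<Rightarrow> real) \<Rightarrow> bool" where
  "mult_mid_convex F \<longleftrightarrow> (\<forall>x>0. \<forall>y>0. (F (sqrt (x * y)))\<^sup>2 \<le> F x * F y)"

definition P_tn :: "real mat set" where
  "P_tn = {A \<in> carrier_mat 2 2.
     transpose_mat A = A \<and> totally_nonneg A \<and> (\<forall>i<2. \<forall>j<2. 0 < A $$ (i, j))}"

definition P_prime :: "real mat set" where
  "P_prime = {mat_of_rows_list 2 [[a, b], [b, a]] | a b.
     a > b \<and> b > 0 \<and> \<not> (a \<notin> \<rat> \<and> b \<notin> \<rat>)}"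

definition P_double_prime :: "real mat set" where
  "P_double_prime = {mat_of_rows_list 2 [[a, b], [b, c]] | a b c.
     a > 0 \<and> b > 0 \<and> c > 0 \<and> a * c > b\<^sup>2 \<and> a \<in> \<rat> \<and> b \<in> \<rat> \<and> c \<in> \<rat>}"

end

theory Submission
  imports Defs
begin

text \<open>Each matrix condition is an inequality \<open>F(b)\<^sup>2 \<le> F(a) F(c)\<close> for certain triples with
  \<open>b\<^sup>2 \<le> a c\<close>. For monotone non-negative \<open>F\<close>, squeezing in rational triples shows that \<open>P_prime\<close> and
  \<open>P_double_prime\<close> give this inequality whenever \<open>b\<^sup>2 < a c\<close>. The strict form already forces
  continuity, and continuity then yields the boundary case \<open>b\<^sup>2 = a c\<close>, which is mid-convexity.\<close>

section \<open>Two-by-two matrices\<close>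

abbreviation sym2 :: "'a \<Rightarrow> 'a \<Rightarrow> 'a \<Rightarrow> 'a mat" where
  "sym2 a b c \<equiv> mat_of_rows_list 2 [[a, b], [b, c]]"

lemma less_two_cases: "(i::nat) < 2 \<longleftrightarrow> i = 0 \<or> i = 1"
  by auto

lemma sym2_carrier: "sym2 a b c \<in> carrier_mat 2 2"
  by (simp add: mat_of_rows_list_def numeral_2_eq_2)

lemma sym2_index:
  "sym2 a b c $$ (0, 0) = a" "sym2 a b c $$ (0, Suc 0) = b"
  "sym2 a b c $$ (Suc 0, 0) = b" "sym2 a b c $$ (Suc 0, Suc 0) = c"
  by (simp_all add: mat_of_rows_list_def numeral_2_eq_2)

lemma map_mat_sym2: "map_mat F (sym2 a b c) = sym2 (F a) (F b) (F c)"
  by (rule eq_matI) (auto simp: mat_of_rows_list_def numeral_2_eq_2 less_Suc_eq)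

lemma transpose_sym2: "transpose_mat (sym2 a b c) = sym2 a b c"
  by (rule eq_matI) (auto simp: mat_of_rows_list_def numeral_2_eq_2 less_Suc_eq)

lemma symmetric_mat2_eq_sym2:
  assumes "A \<in> carrier_mat 2 2" "transpose_mat A = A"
  shows "A = sym2 (A $$ (0, 0)) (A $$ (0, 1)) (A $$ (1, 1))"
proof -
  have "A $$ (1, 0) = transpose_mat A $$ (0, 1)"
    using assms(1) by simp
  then have "A $$ (1, 0) = A $$ (0, 1)"
    using assms(2) by simp
  then show ?thesis
    using assms(1) by (intro eq_matI) (auto simp: mat_of_rows_list_def numeral_2_eq_2 less_Suc_eq)
qed

lemma det_mat2:
  assumes "A \<in> carrier_mat 2 2"
  shows "det A = A $$ (0, 0) * A $$ (1, 1) - A $$ (0, 1) * A $$ (1, 0)"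
proof -
  have "det A = A $$ (0, 0) * cofactor A 0 0 + A $$ (1, 0) * cofactor A 1 0"
    using laplace_expansion_column[OF assms, of 0] by (simp add: numeral_2_eq_2)
  moreover have "cofactor A 0 0 = A $$ (1, 1)" "cofactor A 1 0 = - A $$ (0, 1)"
    using assms by (simp_all add: cofactor_def mat_delete_def det_single)
  ultimately show ?thesis
    by simp
qed

lemma submatrix_singletons:
  assumes "i < dim_row A" "j < dim_col A"
  shows "submatrix A {i} {j} = mat 1 1 (\<lambda>_. A $$ (i, j))"
proof -
  have "{k. k < dim_row A \<and> k \<in> {i}} = {i}" "{k. k < dim_col A \<and> k \<in> {j}} = {j}"
    using assms by auto
  moreover have "pick {k} 0 = k" for k :: nat
    by (simp add: Least_equality)
  ultimately show ?thesis
    by (auto simp: submatrix_def)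
qed

lemma submatrix_full: "submatrix A {..<dim_row A} {..<dim_col A} = A"
proof -
  have "pick {..<n} i = i" if "i < n" for n i :: nat
  proof -
    \<comment> \<open>\<open>pick\<close> counts from 0, so an element with exactly \<open>i\<close>
      smaller elements in the set is the one picked at position \<open>i\<close>.\<close>
    have "{a \<in> {..<n}. a < i} = {..<i}"
      using that by auto
    then show ?thesis
      using that pick_card_in_set[of i "{..<n}"] by simp
  qed
  then show ?thesis
    by (auto simp: submatrix_def)
qed

text \<open>Row and column index sets of a minor have equal size, so in size two only the four
  entries and the full determinant occur.\<close>

lemma totally_nonneg_mat2:
  assumes "A \<in> carrier_mat 2 2"
  shows "totally_nonneg A \<longleftrightarrow>
    (\<forall>i<2. \<forall>j<2. 0 \<le> A $$ (i, j)) \<and> A $$ (0, 1) * A $$ (1, 0) \<le> A $$ (0, 0) * A $$ (1, 1)"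
    (is "_ \<longleftrightarrow> ?entries \<and> ?minor")
proof -
  have dim: "dim_row A = 2" "dim_col A = 2"
    using assms by auto
  have single: "det (submatrix A {i} {j}) = A $$ (i, j)" if "i < 2" "j < 2" for i j
    using that dim by (simp add: submatrix_singletons det_single)
  have full: "det (submatrix A {..<2} {..<2}) = A $$ (0, 0) * A $$ (1, 1) - A $$ (0, 1) * A $$ (1, 0)"
    using submatrix_full[of A] det_mat2[OF assms] dim by simp
  show ?thesis
  proof
    assume tn: "totally_nonneg A"
    have ?entries
    proof (intro allI impI)
      fix i j :: nat
      assume ij: "i < 2" "j < 2"
      then have "0 \<le> det (submatrix A {i} {j})"
        using tn dim unfolding totally_nonneg_def by simp
      then show "0 \<le> A $$ (i, j)"
        using single ij by simp
    qed
    moreover have "0 \<le> det (submatrix A {..<2} {..<2})"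
      using tn dim unfolding totally_nonneg_def by (simp add: lessThan_empty_iff)
    ultimately show "?entries \<and> ?minor"
      using full by simp
  next
    assume R: "?entries \<and> ?minor"
    have subsets: "K = {0} \<or> K = {1} \<or> K = {..<2}" if "K \<subseteq> {..<2}" "K \<noteq> {}" for K :: "nat set"
    proof -
      have "{..<2::nat} = {0, 1}"
        by auto
      then show ?thesis
        using that by auto
    qed
    show "totally_nonneg A"
      unfolding totally_nonneg_def dim
    proof (intro allI impI)
      fix I J :: "nat set"
      assume IJ: "I \<subseteq> {..<2}" "J \<subseteq> {..<2}" "I \<noteq> {}" "card I = card J"
      \<comment> \<open>\<open>card\<close> is 0 on infinite sets as well as on the empty one, so
        \<open>I\<close> must be known finite before \<open>card I = card J\<close> excludes an
        empty \<open>J\<close>.\<close>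
      then have "J \<noteq> {}"
        using finite_subset[OF IJ(1)] by auto
      show "0 \<le> det (submatrix A I J)"
        using subsets[OF IJ(1,3)] subsets[OF IJ(2) \<open>J \<noteq> {}\<close>] IJ(4) R single full
        by (elim disjE) simp_all
    qed
  qed
qed

lemma totally_nonneg_sym2:
  "totally_nonneg (sym2 a b c) \<longleftrightarrow> 0 \<le> a \<and> 0 \<le> b \<and> 0 \<le> c \<and> b\<^sup>2 \<le> a * c"
  unfolding totally_nonneg_mat2[OF sym2_carrier] less_two_cases
  by (auto simp: sym2_index power2_eq_square)

text \<open>Testing the quadratic form at a few vectors yields the inequalities, and completing the
  square recovers the form from them. Unlike in the totally non-negative case, nothing is learnt
  about the sign of \<open>b\<close>.\<close>

lemma pos_semidef_sym2:
  "pos_semidef (sym2 a b c) \<longleftrightarrow> 0 \<le> a \<and> 0 \<le> c \<and> b\<^sup>2 \<le> a * c"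
proof -
  have quad: "v \<bullet> (sym2 a b c *\<^sub>v v) = a * (v $ 0)\<^sup>2 + 2 * b * (v $ 0) * (v $ 1) + c * (v $ 1)\<^sup>2"
    if "v \<in> carrier_vec 2" for v
    using that
    by (simp add: mat_of_rows_list_def scalar_prod_def numeral_2_eq_2 power2_eq_square algebra_simps)
  have "(\<forall>v \<in> carrier_vec 2. 0 \<le> v \<bullet> (sym2 a b c *\<^sub>v v)) \<longleftrightarrow>
      (\<forall>x y. 0 \<le> a * x\<^sup>2 + 2 * b * x * y + c * y\<^sup>2)"
  proof
    assume L: "\<forall>v \<in> carrier_vec 2. 0 \<le> v \<bullet> (sym2 a b c *\<^sub>v v)"
    show "\<forall>x y. 0 \<le> a * x\<^sup>2 + 2 * b * x * y + c * y\<^sup>2"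
    proof (intro allI)
      fix x y :: real
      have "vec_of_list [x, y] \<in> carrier_vec 2"
        by (simp add: carrier_vecI)
      from L[rule_format, OF this] quad[OF this]
      show "0 \<le> a * x\<^sup>2 + 2 * b * x * y + c * y\<^sup>2"
        by simp
    qed
  qed (simp add: quad)
  moreover have "(\<forall>x y. 0 \<le> a * x\<^sup>2 + 2 * b * x * y + c * y\<^sup>2) \<longleftrightarrow> 0 \<le> a \<and> 0 \<le> c \<and> b\<^sup>2 \<le> a * c"
  proof
    assume L: "\<forall>x y. 0 \<le> a * x\<^sup>2 + 2 * b * x * y + c * y\<^sup>2"
    have a: "0 \<le> a" and c: "0 \<le> c"
      using L[rule_format, of 1 0] L[rule_format, of 0 1] by auto
    \<comment> \<open>At the vectors (b, -a) and (c, -b) the form equals the determinant times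
      \<open>a\<close> and times \<open>c\<close>.\<close>
    have "0 \<le> a * (a * c - b\<^sup>2)" "0 \<le> c * (a * c - b\<^sup>2)"
      using L[rule_format, of b "- a"] L[rule_format, of c "- b"]
      by (auto simp: power2_eq_square algebra_simps)
    \<comment> \<open>With a zero diagonal the previous bounds are void; the vector (1, -b) then
      forces \<open>b = 0\<close>.\<close>
    moreover have "0 \<le> - 2 * b\<^sup>2" if "a = 0" "c = 0"
      using L[rule_format, of 1 "- b"] that by (simp add: power2_eq_square)
    ultimately show "0 \<le> a \<and> 0 \<le> c \<and> b\<^sup>2 \<le> a * c"
      using a c by (cases "a = 0"; cases "c = 0") (auto simp: zero_le_mult_iff mult_le_0_iff)
  next
    assume R: "0 \<le> a \<and> 0 \<le> c \<and> b\<^sup>2 \<le> a * c"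
    show "\<forall>x y. 0 \<le> a * x\<^sup>2 + 2 * b * x * y + c * y\<^sup>2"
    proof (intro allI)
      fix x y :: real
      show "0 \<le> a * x\<^sup>2 + 2 * b * x * y + c * y\<^sup>2"
      proof (cases "a = 0")
        case True
        then show ?thesis using R by simp
      next
        case False
        \<comment> \<open>Completing the square in \<open>a\<close> times the form; dividing by
          \<open>a > 0\<close> then keeps the sign.\<close>
        have "0 \<le> (a * x + b * y)\<^sup>2 + (a * c - b\<^sup>2) * y\<^sup>2"
          using R by simp
        also have "\<dots> = a * (a * x\<^sup>2 + 2 * b * x * y + c * y\<^sup>2)"
          by (simp add: power2_eq_square algebra_simps)
        finally show ?thesis
          using R False by (simp add: zero_le_mult_iff)
      qed
    qed
  qed
  moreover have "dim_row (sym2 a b c) = 2" "square_mat (sym2 a b c)"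
    using sym2_carrier[of a b c] by auto
  ultimately show ?thesis
    by (simp add: pos_semidef_def transpose_sym2)
qed

text \<open>Brings \<open>P_tn\<close> into the parametrised shape of \<open>P_prime\<close> and
  \<open>P_double_prime\<close>, so that all three become sets of triples.\<close>

lemma P_tn_eq: "P_tn = {sym2 a b c | a b c. 0 < a \<and> 0 < b \<and> 0 < c \<and> b\<^sup>2 \<le> a * c}"
proof (intro subset_antisym subsetI)
  fix A assume A: "A \<in> P_tn"
  then have eq: "A = sym2 (A $$ (0, 0)) (A $$ (0, 1)) (A $$ (1, 1))"
    unfolding P_tn_def by (blast intro: symmetric_mat2_eq_sym2)
  moreover have "totally_nonneg (sym2 (A $$ (0, 0)) (A $$ (0, 1)) (A $$ (1, 1)))"
    using A eq unfolding P_tn_def by auto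
  then have "(A $$ (0, 1))\<^sup>2 \<le> A $$ (0, 0) * A $$ (1, 1)"
    unfolding totally_nonneg_sym2 by blast
  moreover have "0 < A $$ (0, 0)" "0 < A $$ (0, 1)" "0 < A $$ (1, 1)"
    using A unfolding P_tn_def by auto
  ultimately show "A \<in> {sym2 a b c | a b c. 0 < a \<and> 0 < b \<and> 0 < c \<and> b\<^sup>2 \<le> a * c}"
    by blast
next
  fix A :: "real mat"
  assume "A \<in> {sym2 a b c | a b c. 0 < a \<and> 0 < b \<and> 0 < c \<and> b\<^sup>2 \<le> a * c}"
  then obtain a b c where A: "A = sym2 a b c" "0 < a" "0 < b" "0 < c" "b\<^sup>2 \<le> a * c"
    by blast
  then have "totally_nonneg A"
    by (simp add: totally_nonneg_sym2)
  then show "A \<in> P_tn"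
    using A(2-4) unfolding P_tn_def A(1) less_two_cases
    by (auto simp: sym2_carrier transpose_sym2 sym2_index)
qed

section \<open>Functions on the half-line\<close>

text \<open>Monotonicity moves \<open>b\<close> up to the geometric mean of \<open>a\<close> and
  \<open>c\<close>, where mid-convexity applies.\<close>

lemma mult_mid_convexD:
  assumes nonneg: "\<forall>x>0. 0 \<le> F x" and mono: "mono_on {0<..} F" and conv: "mult_mid_convex F"
    and "0 < a" "0 < b" "0 < c" "b\<^sup>2 \<le> a * c"
  shows "(F b)\<^sup>2 \<le> F a * F c"
proof -
  have "b \<le> sqrt (a * c)"
    using \<open>b\<^sup>2 \<le> a * c\<close> by (rule real_le_rsqrt)
  then have "F b \<le> F (sqrt (a * c))"
    using assms by (intro mono_onD[OF mono]) auto
  then have "(F b)\<^sup>2 \<le> (F (sqrt (a * c)))\<^sup>2"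
    using nonneg \<open>0 < b\<close> by (intro power_mono) auto
  also have "\<dots> \<le> F a * F c"
    using conv assms unfolding mult_mid_convex_def by auto
  finally show ?thesis .
qed

text \<open>A zero at \<open>a\<close> makes the right-hand side vanish, while a large
  \<open>c\<close> lets \<open>b\<close> be any positive number.\<close>

lemma zero_or_pos:
  fixes F :: "real \<Rightarrow> real"
  assumes F: "\<And>a b c. \<lbrakk>0 < a; 0 < b; 0 < c; b\<^sup>2 < a * c\<rbrakk> \<Longrightarrow> (F b)\<^sup>2 \<le> F a * F c"
  shows "(\<forall>x>0. F x \<noteq> 0) \<or> (\<forall>x>0. F x = 0)"
proof (rule disjCI)
  assume "\<not> (\<forall>x>0. F x = 0)"
  then obtain x where x: "0 < x" "F x \<noteq> 0"
    by blast
  show "\<forall>z>0. F z \<noteq> 0"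
  proof (intro allI impI notI)
    fix z :: real
    assume z: "0 < z" "F z = 0"
    have "x\<^sup>2 < z * ((x\<^sup>2 + 1) / z)"
      using z by simp
    then have "(F x)\<^sup>2 \<le> F z * F ((x\<^sup>2 + 1) / z)"
      using x z by (intro F) (auto intro!: divide_pos_pos add_nonneg_pos)
    then show False
      using x z by simp
  qed
qed

text \<open>If a monotone function jumps at \<open>x\<close>, then letting \<open>b\<close> and \<open>c\<close> tend to \<open>x\<close> from
  above and keeping \<open>a\<close> below \<open>x\<close> violates the inequality between the one-sided limits.\<close>

lemma right_limit_le:
  fixes F :: "real \<Rightarrow> real"
  assumes pos: "\<And>x. 0 < x \<Longrightarrow> 0 < F x"
    and F: "\<And>a b c. \<lbrakk>0 < a; 0 < b; 0 < c; b\<^sup>2 < a * c\<rbrakk> \<Longrightarrow> (F b)\<^sup>2 \<le> F a * F c"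
    and mono: "mono_on {0<..} F" and x: "0 < x"
    and bound: "\<And>a. \<lbrakk>0 < a; a < x\<rbrakk> \<Longrightarrow> F a \<le> p"
  shows "Inf (F ` {x<..}) \<le> p"
proof -
  \<comment> \<open>As \<open>F\<close> is monotone, \<open>R\<close> is its right-hand limit at
    \<open>x\<close>.\<close>
  define R where "R = Inf (F ` {x<..})"
  have bdd: "bdd_below (F ` {x<..})"
    using x pos by (intro bdd_belowI[of _ 0]) (auto intro: less_imp_le order.strict_trans)
  have "F x \<le> R"
    unfolding R_def using x by (intro cINF_greatest) (auto intro!: mono_onD[OF mono])
  then have R: "0 < R"
    using pos[OF x] by linarith
  have p: "0 < p"
    using bound[of "x / 2"] pos[of "x / 2"] x by simp
  \<comment> \<open>Taking the infimum over \<open>c\<close> will give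
    \<open>R\<^sup>2 / p \<le> R\<close>, hence \<open>R \<le> p\<close>.\<close>
  have "R\<^sup>2 / p \<le> F c" if c: "x < c" for c
  proof -
    \<comment> \<open>Any point strictly between \<open>x\<close> and \<open>sqrt (x * c)\<close>
      would do: it leaves room for some \<open>a < x\<close> with
      \<open>b\<^sup>2 < a * c\<close>.\<close>
    define b where "b = (x + sqrt (x * c)) / 2"
    have "x < sqrt (x * c)"
      using x c by (intro real_less_rsqrt) (simp add: power2_eq_square)
    then have b: "x < b" "b < sqrt (x * c)"
      by (auto simp: b_def)
    have "b\<^sup>2 < (sqrt (x * c))\<^sup>2"
      using b x by (intro power_strict_mono) auto
    then have b2: "b\<^sup>2 / c < x"
      using x c by (simp add: field_simps)
    then obtain a where a: "b\<^sup>2 / c < a" "a < x"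
      using dense by blast
    have a0: "0 < a"
      using a(1) x c by (smt (verit) zero_le_power2 divide_nonneg_pos)
    have "R \<le> F b"
      unfolding R_def using b bdd by (intro cINF_lower) auto
    then have "R\<^sup>2 \<le> (F b)\<^sup>2"
      using R by (intro power_mono) auto
    also have "\<dots> \<le> F a * F c"
      using a a0 b x c by (intro F) (auto simp: field_simps)
    also have "\<dots> \<le> p * F c"
      using bound[OF a0 a(2)] pos[of c] x c by (intro mult_right_mono) auto
    finally show ?thesis
      using p by (simp add: field_simps)
  qed
  then have "R\<^sup>2 / p \<le> R"
    unfolding R_def by (intro cINF_greatest) auto
  then have "R * R \<le> p * R"
    using p by (simp add: field_simps power2_eq_square)
  then show ?thesis
    using R by (simp add: R_def)
qed

text \<open>Unless \<open>F\<close> vanishes identically, it is positive. The bound on its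
  right-hand limit then excludes jumps, and monotonicity extends the resulting estimates from single
  points to neighbourhoods.\<close>

lemma continuous_on_halfline:
  fixes F :: "real \<Rightarrow> real"
  assumes nonneg: "\<forall>x>0. 0 \<le> F x" and mono: "mono_on {0<..} F"
    and F: "\<And>a b c. \<lbrakk>0 < a; 0 < b; 0 < c; b\<^sup>2 < a * c\<rbrakk> \<Longrightarrow> (F b)\<^sup>2 \<le> F a * F c"
  shows "continuous_on {0<..} F"
  using zero_or_pos[of F, OF F]
proof
  assume "\<forall>x>0. F x = 0"
  then show ?thesis
    using continuous_on_cong[of "{0<..}" "{0<..}" F "\<lambda>_. 0"] by simp
next
  assume "\<forall>x>0. F x \<noteq> 0"
  then have pos: "0 < F x" if "0 < x" for x
    using nonneg that by (simp add: order.strict_iff_order)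
  have "isCont F x" if x: "0 < x" for x
    unfolding isCont_def
  proof (rule order_tendstoI)
    fix p assume p: "p < F x"
    have "F x \<le> Inf (F ` {x<..})"
      using x by (intro cINF_greatest) (auto intro!: mono_onD[OF mono])
    with p have "\<not> Inf (F ` {x<..}) \<le> p"
      by linarith
    \<comment> \<open>Otherwise \<open>p\<close> would bound \<open>F\<close> on the left of
      \<open>x\<close>, hence also the right-hand limit.\<close>
    then obtain a where a: "0 < a" "a < x" "p < F a"
      using right_limit_le[OF pos F mono x, of p] by force
    have "\<forall>\<^sub>F y in at x. a < y"
      using a(2) by (rule order_tendstoD(1)[OF tendsto_ident_at])
    then show "\<forall>\<^sub>F y in at x. p < F y"
    proof eventually_elim
      case (elim y)
      then have "F a \<le> F y"
        using a by (intro mono_onD[OF mono]) auto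
      then show ?case
        using a by linarith
    qed
  next
    fix p assume p: "F x < p"
    \<comment> \<open>By monotonicity \<open>F x\<close> is itself a bound for the values on the
      left of \<open>x\<close>.\<close>
    have "Inf (F ` {x<..}) \<le> F x"
      using x by (intro right_limit_le[OF pos F mono x]) (auto intro!: mono_onD[OF mono])
    with p have "Inf (F ` {x<..}) < p"
      by linarith
    then obtain b where b: "x < b" "F b < p"
      using cInf_lessD[of "F ` {x<..}" p] by auto
    have "\<forall>\<^sub>F y in at x. y < b" "\<forall>\<^sub>F y in at x. 0 < y"
      using b(1) x by (auto intro: order_tendstoD[OF tendsto_ident_at])
    then show "\<forall>\<^sub>F y in at x. F y < p"
    proof eventually_elim
      case (elim y)
      then have "F y \<le> F b"
        using b x by (intro mono_onD[OF mono]) auto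
      then show ?case
        using b by linarith
    qed
  qed
  then show ?thesis
    by (auto intro: continuous_at_imp_continuous_on)
qed

text \<open>The boundary case is a limit of strict ones: with \<open>b = sqrt (x * y)\<close> fixed,
  shift \<open>x\<close> and \<open>y\<close> up by \<open>t\<close> and let \<open>t\<close> tend
  to 0.\<close>

lemma mult_mid_convex_if_strict:
  fixes F :: "real \<Rightarrow> real"
  assumes nonneg: "\<forall>x>0. 0 \<le> F x" and mono: "mono_on {0<..} F"
    and F: "\<And>a b c. \<lbrakk>0 < a; 0 < b; 0 < c; b\<^sup>2 < a * c\<rbrakk> \<Longrightarrow> (F b)\<^sup>2 \<le> F a * F c"
  shows "mult_mid_convex F"
  unfolding mult_mid_convex_def
proof (intro allI impI)
  fix x y :: real
  assume xy: "0 < x" "0 < y"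
  have "continuous_on {0<..} F"
    using assms by (rule continuous_on_halfline)
  then have cont: "isCont F z" if "0 < z" for z
    using that by (simp add: continuous_on_eq_continuous_at)
  have "((\<lambda>t. F (x + t)) \<longlongrightarrow> F x) (at_right 0)" "((\<lambda>t. F (y + t)) \<longlongrightarrow> F y) (at_right 0)"
    using xy by (auto intro!: isCont_tendsto_compose[OF cont] tendsto_eq_intros)
  then have "((\<lambda>t. F (x + t) * F (y + t)) \<longlongrightarrow> F x * F y) (at_right 0)"
    by (rule tendsto_mult)
  moreover have "\<forall>\<^sub>F t in at_right 0. (F (sqrt (x * y)))\<^sup>2 \<le> F (x + t) * F (y + t)"
    using eventually_at_right_less
  proof eventually_elim
    case (elim t)
    then have "x * y < (x + t) * (y + t)"
      using xy by (intro mult_strict_mono) auto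
    then show ?case
      using xy elim by (intro F) auto
  qed
  ultimately show "(F (sqrt (x * y)))\<^sup>2 \<le> F x * F y"
    by (rule tendsto_lowerbound) simp
qed

lemma Rats_betweenE:
  fixes x y :: real
  assumes "x < y"
  obtains q where "q \<in> \<rat>" "x < q" "q < y"
  using Rats_dense_in_real[OF assms] by blast

section \<open>The equivalences\<close>

text \<open>Constant matrices give non-negativity, \<open>sym2 y x y\<close> with
  \<open>x \<le> y\<close> gives monotonicity, and singular matrices give mid-convexity.\<close>

lemma tn_preserver_iff:
  "(\<forall>A\<in>P_tn. totally_nonneg (map_mat F A)) \<longleftrightarrow>
    (\<forall>x>0. 0 \<le> F x) \<and> mono_on {0<..} F \<and> mult_mid_convex F"
proof
  assume "\<forall>A\<in>P_tn. totally_nonneg (map_mat F A)"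
  then have tn: "0 \<le> F a \<and> 0 \<le> F b \<and> 0 \<le> F c \<and> (F b)\<^sup>2 \<le> F a * F c"
    if "0 < a" "0 < b" "0 < c" "b\<^sup>2 \<le> a * c" for a b c
  proof -
    have "sym2 a b c \<in> P_tn"
      using that unfolding P_tn_eq by blast
    then have "totally_nonneg (map_mat F (sym2 a b c))"
      using \<open>\<forall>A\<in>P_tn. _ A\<close> by blast
    then show ?thesis
      unfolding map_mat_sym2 totally_nonneg_sym2 .
  qed
  have nonneg: "\<forall>x>0. 0 \<le> F x"
    using tn by (metis order_refl power2_eq_square)
  moreover have "mono_on {0<..} F"
  proof (rule mono_onI)
    fix x y :: real
    assume "x \<in> {0<..}" "y \<in> {0<..}" "x \<le> y"
    then have "x\<^sup>2 \<le> y * y"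
      by (simp add: power2_eq_square mult_mono)
    then have "(F x)\<^sup>2 \<le> (F y)\<^sup>2" "0 \<le> F y"
      using tn[of y x y] \<open>x \<in> _\<close> \<open>y \<in> _\<close> by (auto simp: power2_eq_square)
    then show "F x \<le> F y"
      by (rule power2_le_imp_le)
  qed
  moreover have "mult_mid_convex F"
    unfolding mult_mid_convex_def using tn by simp
  ultimately show "(\<forall>x>0. 0 \<le> F x) \<and> mono_on {0<..} F \<and> mult_mid_convex F"
    by blast
next
  assume "(\<forall>x>0. 0 \<le> F x) \<and> mono_on {0<..} F \<and> mult_mid_convex F"
  then show "\<forall>A\<in>P_tn. totally_nonneg (map_mat F A)"
    unfolding P_tn_eq by (auto simp: map_mat_sym2 totally_nonneg_sym2 intro: mult_mid_convexD)
qed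

text \<open>For the converse, \<open>P_prime\<close> supplies sign and monotonicity, and
  \<open>P_double_prime\<close> supplies the strict inequality at rational triples.\<close>

lemma psd_preserver_iff:
  "(\<forall>x>0. 0 \<le> F x) \<and> mono_on {0<..} F \<and> mult_mid_convex F \<longleftrightarrow>
    (\<forall>A \<in> P_prime \<union> P_double_prime. pos_semidef (map_mat F A))"
proof
  assume F: "(\<forall>x>0. 0 \<le> F x) \<and> mono_on {0<..} F \<and> mult_mid_convex F"
  have "pos_semidef (map_mat F (sym2 a b c))"
    if "0 < a" "0 < b" "0 < c" "b\<^sup>2 \<le> a * c" for a b c
    using F that by (auto simp: map_mat_sym2 pos_semidef_sym2 intro: mult_mid_convexD)
  moreover have "b\<^sup>2 \<le> a * a" if "b < a" "0 < b" for a b :: real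
    using that by (simp add: power2_eq_square mult_mono)
  ultimately show "\<forall>A \<in> P_prime \<union> P_double_prime. pos_semidef (map_mat F A)"
    unfolding P_prime_def P_double_prime_def by force
next
  assume psd: "\<forall>A \<in> P_prime \<union> P_double_prime. pos_semidef (map_mat F A)"
  have prime: "0 \<le> F a \<and> \<bar>F b\<bar> \<le> F a" if "b < a" "0 < b" "a \<in> \<rat> \<or> b \<in> \<rat>" for a b
  proof -
    have "sym2 a b a \<in> P_prime"
      using that unfolding P_prime_def by blast
    then have "pos_semidef (map_mat F (sym2 a b a))"
      using psd by blast
    then have "pos_semidef (sym2 (F a) (F b) (F a))"
      unfolding map_mat_sym2 .
    then have "0 \<le> F a" "(F b)\<^sup>2 \<le> (F a)\<^sup>2"
      unfolding pos_semidef_sym2 by (auto simp: power2_eq_square)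
    then show ?thesis
      using abs_le_square_iff[of "F b" "F a"] by simp
  qed
  have rational: "(F b)\<^sup>2 \<le> F a * F c"
    if "0 < a" "0 < b" "0 < c" "b\<^sup>2 < a * c" "a \<in> \<rat>" "b \<in> \<rat>" "c \<in> \<rat>" for a b c
  proof -
    have "sym2 a b c \<in> P_double_prime"
      using that unfolding P_double_prime_def by blast
    then have "pos_semidef (map_mat F (sym2 a b c))"
      using psd by blast
    then have "pos_semidef (sym2 (F a) (F b) (F c))"
      unfolding map_mat_sym2 .
    then show ?thesis
      by (simp add: pos_semidef_sym2)
  qed
  have nonneg: "\<forall>x>0. 0 \<le> F x"
  proof (intro allI impI)
    fix x :: real
    assume "0 < x"
    then obtain q where "q \<in> \<rat>" "0 < q" "q < x"
      by (rule Rats_betweenE)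
    then show "0 \<le> F x"
      using prime by blast
  qed
  have mono: "mono_on {0<..} F"
  proof (rule mono_onI)
    fix x y :: real
    assume xy: "x \<in> {0<..}" "y \<in> {0<..}" "x \<le> y"
    show "F x \<le> F y"
    proof (cases "x = y")
      case False
      with xy have "x < y"
        by simp
      \<comment> \<open>If \<open>x\<close> and \<open>y\<close> are both irrational,
        \<open>P_prime\<close> does not compare them directly; a rational \<open>q\<close> in
        between links them.\<close>
      then obtain q where q: "q \<in> \<rat>" "x < q" "q < y"
        by (rule Rats_betweenE)
      then show ?thesis
        using prime[of x q] prime[of q y] xy by auto
    qed simp
  qed
  have strict: "(F b)\<^sup>2 \<le> F a * F c" if abc: "0 < a" "0 < b" "0 < c" "b\<^sup>2 < a * c" for a b c
  proof -
    \<comment> \<open>Raise \<open>b\<close>, then lower \<open>a\<close>, then lower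
      \<open>c\<close> to rationals, keeping the strict inequality each time. By monotonicity the
      left side only grows and the right side only shrinks, so the rational case suffices.\<close>
    have "b < sqrt (a * c)"
      using abc(4) by (rule real_less_rsqrt)
    then obtain b' where b': "b' \<in> \<rat>" "b < b'" "b' < sqrt (a * c)"
      by (rule Rats_betweenE)
    have "b'\<^sup>2 < (sqrt (a * c))\<^sup>2"
      using b' abc by (intro power_strict_mono) auto
    then have "b'\<^sup>2 / c < a"
      using abc by (simp add: field_simps)
    then obtain a' where a': "a' \<in> \<rat>" "b'\<^sup>2 / c < a'" "a' < a"
      by (rule Rats_betweenE)
    have a'_pos: "0 < a'"
      using a' b' abc by (smt (verit) zero_le_power2 divide_nonneg_pos)
    have "b'\<^sup>2 / a' < c"
      using a' a'_pos abc by (simp add: field_simps)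
    then obtain c' where c': "c' \<in> \<rat>" "b'\<^sup>2 / a' < c'" "c' < c"
      by (rule Rats_betweenE)
    have c'_pos: "0 < c'"
      using c' a'_pos by (smt (verit) zero_le_power2 divide_nonneg_pos)
    have "(F b)\<^sup>2 \<le> (F b')\<^sup>2"
      using nonneg abc b' by (intro power_mono mono_onD[OF mono]) auto
    also have "\<dots> \<le> F a' * F c'"
      using a' b' c' a'_pos c'_pos abc by (intro rational) (auto simp: field_simps)
    also have "\<dots> \<le> F a * F c"
      using nonneg a' c' a'_pos c'_pos abc by (intro mult_mono mono_onD[OF mono]) auto
    finally show ?thesis .
  qed
  show "(\<forall>x>0. 0 \<le> F x) \<and> mono_on {0<..} F \<and> mult_mid_convex F"
    using nonneg mono mult_mid_convex_if_strict[OF nonneg mono strict] by blast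
qed

theorem theorem5p2:
  fixes F :: "real \<Rightarrow> real"
  shows
    "((\<forall>A\<in>P_tn. totally_nonneg (map_mat F A)) \<longleftrightarrow>
       ((\<forall>x>0. 0 \<le> F x) \<and> mono_on {0<..} F \<and> mult_mid_convex F)) \<and>
     (((\<forall>x>0. 0 \<le> F x) \<and> mono_on {0<..} F \<and> mult_mid_convex F) \<longleftrightarrow>
       (\<forall>A \<in> P_prime \<union> P_double_prime. pos_semidef (map_mat F A))) \<and>
     (((\<forall>x>0. 0 \<le> F x) \<and> mono_on {0<..} F \<and> mult_mid_convex F) \<longrightarrow>
       continuous_on {0<..} F \<and> ((\<forall>x>0. F x \<noteq> 0) \<or> (\<forall>x>0. F x = 0)))"
proof (rule conjI[OF tn_preserver_iff conjI[OF psd_preserver_iff impI]])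
  assume F: "(\<forall>x>0. 0 \<le> F x) \<and> mono_on {0<..} F \<and> mult_mid_convex F"
  then have strict: "(F b)\<^sup>2 \<le> F a * F c" if "0 < a" "0 < b" "0 < c" "b\<^sup>2 < a * c" for a b c
    using that by (auto intro: mult_mid_convexD)
  show "continuous_on {0<..} F \<and> ((\<forall>x>0. F x \<noteq> 0) \<or> (\<forall>x>0. F x = 0))"
    using F continuous_on_halfline[of F, OF _ _ strict] zero_or_pos[of F, OF strict] by blast
qed

end
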